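(* Every $3$-edge-colorable graph is $(7,2)$-edge-choosable.
   Context: A graph $G$ is $(r,s)$-edge-choosable if for every assignment $L$ of lists of size $r$ to the edges of $G$, one can choose for each edge $e$ a set of $s$ colors from $L(e)$ so that incident edges (edges sharing an endpoint) receive disjoint sets. A graph is $3$-edge-colorable if its edges can be colored with $3$ colors so that incident edges get different colors. *)

theory Defs
  imports Main
begin

text \<open>Finite simple undirected graphs, with edges as two-element sets of vertices.\<close>

definition finite_simple_graph :: "'v set \<Rightarrow> 'v set set \<Rightarrow> bool" where
  "finite_simple_graph V E \<longleftrightarrow> finite V \<and> (\<forall>e\<in>E. e \<subseteq> V \<and> card e = 2)"

definition incident_edges :: "'v set \<Rightarrow> 'v set \<Rightarrow> bool" where
  "incident_edges e f \<longleftrightarrow> e \<noteq> f \<and> e \<inter> f \<noteq> {}"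

definition edge_colorable :: "nat \<Rightarrow> 'v set set \<Rightarrow> bool" where
  "edge_colorable k E \<longleftrightarrow>
     (\<exists>c :: 'v set \<Rightarrow> nat. (\<forall>e\<in>E. c e < k) \<and>
        (\<forall>e\<in>E. \<forall>f\<in>E. incident_edges e f \<longrightarrow> c e \<noteq> c f))"

text \<open>The first argument only fixes the type from which the list colors are drawn;
  leaving \<open>'c\<close> free in a theorem quantifies over all color types.\<close>

definition edge_choosable :: "'c itself \<Rightarrow> nat \<Rightarrow> nat \<Rightarrow> 'v set set \<Rightarrow> bool" where
  "edge_choosable _ r s E \<longleftrightarrow>
     (\<forall>L :: 'v set \<Rightarrow> 'c set. (\<forall>e\<in>E. finite (L e) \<and> card (L e) = r) \<longrightarrow>
        (\<exists>S :: 'v set \<Rightarrow> 'c set.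
           (\<forall>e\<in>E. S e \<subseteq> L e \<and> card (S e) = s) \<and>
           (\<forall>e\<in>E. \<forall>f\<in>E. incident_edges e f \<longrightarrow> S e \<inter> S f = {})))"

end

theory Submission
  imports Defs
begin

text \<open>
  Let \<open>X\<close>, \<open>Y\<close> be matchings whose edges have lists of at least \<open>k\<close> colors. One can choose a
  color for each edge of \<open>X\<close> so that every edge of \<open>Y\<close> keeps at least \<open>k - 1\<close> colors: trim the
  lists to size \<open>k\<close>; either incident edges always have equal lists and one repeats a color along
  each component of \<open>X \<union> Y\<close>, or some \<open>x\<close> has a color missing from the list of a neighbor \<open>y\<close>;
  start with that color at \<open>x\<close> and go around the component in the direction away from \<open>y\<close>.

  Let \<open>A\<close>, \<open>B\<close>, \<open>C\<close> be the color classes. Choosing a color for every edge of \<open>C\<close> with respect to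
  \<open>A\<close> leaves lists of sizes at least \<open>6, 5, 6\<close> on \<open>A, B, C\<close>; choosing a second color for \<open>C\<close>
  with respect to \<open>B\<close> leaves at least \<open>4, 4\<close> on \<open>A, B\<close>. Choosing twice for \<open>A\<close> with
  respect to \<open>B\<close> leaves at least two colors for each edge of \<open>B\<close>.
\<close>

section \<open>Color choices in bipartite graphs of maximum degree two\<close>

text \<open>The second clause bounds a loss: deleting from \<open>M y\<close> all colors given to
  neighbors of \<open>y\<close> removes at most one element.\<close>

definition sparse_choice ::
  "('x \<Rightarrow> 'y \<Rightarrow> bool) \<Rightarrow> ('x \<Rightarrow> 'c set) \<Rightarrow> ('y \<Rightarrow> 'c set) \<Rightarrow> 'x set \<Rightarrow> 'y set \<Rightarrow> ('x \<Rightarrow> 'c) \<Rightarrow> bool"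
  where "sparse_choice adj L M X Y c \<longleftrightarrow> (\<forall>x\<in>X. c x \<in> L x) \<and>
    (\<forall>y\<in>Y. \<forall>x\<in>X. \<forall>x'\<in>X. adj x y \<longrightarrow> adj x' y \<longrightarrow> c x \<in> M y \<longrightarrow> c x' \<in> M y \<longrightarrow> c x = c x')"

lemma card_le_1_eqD:
  assumes "finite S" "card S \<le> 1" "a \<in> S" "b \<in> S"
  shows "a = b"
  using assms card_le_Suc0_iff_eq by fastforce

text \<open>If \<open>g\<close> lies in \<open>M\<close> but not in \<open>L\<close>, then
  \<open>L \<subseteq> M\<close> would force \<open>L = M\<close> by cardinality, so
  \<open>L\<close> has a color outside \<open>M\<close>. Otherwise \<open>g\<close> itself or any
  color of \<open>L\<close> serves.\<close>

lemma propagate_color: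
  assumes "finite M" "card M \<le> card L" "L \<noteq> {}"
  shows "\<exists>d\<in>L. d = g \<or> g \<notin> M \<or> d \<notin> M"
proof (cases "g \<in> M \<and> g \<notin> L")
  case True
  then have "\<not> L \<subseteq> M"
    using assms(1,2) by (metis card_seteq)
  then show ?thesis by blast
next
  case False
  then show ?thesis using assms(3) by blast
qed

text \<open>The second conclusion allows a prescribed color at an endpoint; it is what makes the
  induction work, as it carries the color chosen for the vertex just deleted.\<close>

lemma sparse_choice_exists_aux:
  fixes adj :: "'x \<Rightarrow> 'y \<Rightarrow> bool" and L :: "'x \<Rightarrow> 'c set"
  assumes "finite X" "finite Y" "k \<ge> 1"
    and "\<And>x. x \<in> X \<Longrightarrow> finite (L x) \<and> card (L x) = k"
    and "\<And>y. y \<in> Y \<Longrightarrow> finite (M y) \<and> card (M y) = k"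
    and "\<And>x. x \<in> X \<Longrightarrow> card {y \<in> Y. adj x y} \<le> 2"
    and "\<And>y. y \<in> Y \<Longrightarrow> card {x \<in> X. adj x y} \<le> 2"
  shows "(\<exists>c. sparse_choice adj L M X Y c) \<and>
    (\<forall>u\<in>X. \<forall>g\<in>L u. card {y \<in> Y. adj u y} \<le> 1 \<longrightarrow> (\<exists>c. sparse_choice adj L M X Y c \<and> c u = g))"
  using assms
proof (induction "card X" arbitrary: X Y rule: less_induct)
  case less
  note fX = less.prems(1) and fY = less.prems(2) and k = less.prems(3)
    and L = less.prems(4) and M = less.prems(5) and dX = less.prems(6) and dY = less.prems(7)
  have Lne: "L x \<noteq> {}" if "x \<in> X" for x
    using L[OF that] k by auto
  \<comment> \<open>Besides \<open>Y\<close> itself, a set \<open>Y'\<close> smaller than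
    \<open>Y\<close> is needed below, where one vertex is set aside to bring the degree of
    \<open>u\<close> down to one.\<close>
  have pre: "\<exists>c. sparse_choice adj L M X Y' c \<and> c u = g"
    if u: "u \<in> X" and g: "g \<in> L u" and Y': "Y' \<subseteq> Y" and d: "card {y \<in> Y'. adj u y} \<le> 1" for u g Y'
  proof -
    define Y1 where "Y1 = {y \<in> Y'. \<not> adj u y}"
    have fY': "finite Y'" using Y' fY finite_subset by blast
    have Y1: "Y1 \<subseteq> Y" "finite Y1"
      using Y' fY' by (auto simp: Y1_def)
    have IH: "(\<exists>c. sparse_choice adj L M (X - {u}) Y1 c) \<and>
      (\<forall>w\<in>X - {u}. \<forall>g\<in>L w. card {y \<in> Y1. adj w y} \<le> 1 \<longrightarrow>
        (\<exists>c. sparse_choice adj L M (X - {u}) Y1 c \<and> c w = g))"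
    proof (rule less.hyps)
      show "card (X - {u}) < card X" using u fX by (rule card_Diff1_less[rotated])
      show "finite (X - {u})" "finite Y1" "1 \<le> k" using fX Y1 k by auto
      show "finite (L x) \<and> card (L x) = k" if "x \<in> X - {u}" for x using L that by auto
      show "finite (M y) \<and> card (M y) = k" if "y \<in> Y1" for y using M Y1 that by auto
      show "card {y \<in> Y1. adj x y} \<le> 2" if "x \<in> X - {u}" for x
      proof -
        have "card {y \<in> Y1. adj x y} \<le> card {y \<in> Y. adj x y}"
          using Y1 fY by (intro card_mono) auto
        then show ?thesis using dX[of x] that by simp
      qed
      show "card {x \<in> X - {u}. adj x y} \<le> 2" if "y \<in> Y1" for y
      proof -
        have "card {x \<in> X - {u}. adj x y} \<le> card {x \<in> X. adj x y}"
          using fX by (intro card_mono) auto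
        then show ?thesis using dY[of y] that Y1 by force
      qed
    qed
    show ?thesis
    proof (cases "\<exists>y\<in>Y'. \<exists>w\<in>X. adj u y \<and> adj w y \<and> w \<noteq> u")
      case False
      obtain c where c: "sparse_choice adj L M (X - {u}) Y1 c" using IH by blast
      have "sparse_choice adj L M X Y' (c(u := g))"
        using c g False by (auto simp: sparse_choice_def Y1_def)
      then show ?thesis by (intro exI[of _ "c(u := g)"]) simp
    next
      case True
      then obtain y w where y: "y \<in> Y'" "adj u y" and w: "w \<in> X" "adj w y" "w \<noteq> u" by blast
      have only_y: "y' = y" if "y' \<in> Y'" "adj u y'" for y'
        using card_le_1_eqD[OF _ d, of y' y] fY' y that by auto
      have only_w: "x = u \<or> x = w" if "x \<in> X" "adj x y" for x
      proof (rule ccontr)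
        assume "\<not> (x = u \<or> x = w)"
        then have "card {u, w, x} = 3" using w by auto
        moreover have "card {u, w, x} \<le> card {x \<in> X. adj x y}"
          using fX u y w that by (intro card_mono) auto
        ultimately show False using dY[of y] y Y' by force
      qed
      \<comment> \<open>The color \<open>h\<close> for \<open>w\<close> is chosen so that
        \<open>y\<close>, whose only neighbors are \<open>u\<close> and \<open>w\<close>, loses at
        most one color.\<close>
      have "\<exists>h\<in>L w. h = g \<or> g \<notin> M y \<or> h \<notin> M y"
        using L[OF w(1)] M[of y] y Y' Lne[OF w(1)] by (intro propagate_color) auto
      then obtain h where h: "h \<in> L w" "h = g \<or> g \<notin> M y \<or> h \<notin> M y" by blast
      \<comment> \<open>Deleting \<open>y\<close> makes \<open>w\<close> an endpoint, so the
        induction hypothesis may prescribe \<open>h\<close> there.\<close>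
      have "card {y \<in> Y1. adj w y} < card {y \<in> Y. adj w y}"
        using fY Y1 y w Y' by (intro psubset_card_mono) (auto simp: Y1_def)
      then have "card {y \<in> Y1. adj w y} \<le> 1" using dX[OF w(1)] by simp
      then obtain c where c: "sparse_choice adj L M (X - {u}) Y1 c" "c w = h"
        using IH w h by blast
      have "sparse_choice adj L M X Y' (c(u := g))"
        unfolding sparse_choice_def
      proof (intro conjI ballI impI)
        fix x assume "x \<in> X"
        then show "(c(u := g)) x \<in> L x" using c g by (auto simp: sparse_choice_def)
      next
        fix z x x'
        assume *: "z \<in> Y'" "x \<in> X" "x' \<in> X" "adj x z" "adj x' z"
          "(c(u := g)) x \<in> M z" "(c(u := g)) x' \<in> M z"
        show "(c(u := g)) x = (c(u := g)) x'"
        proof (cases "adj u z")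
          case True
          then have "z = y" using only_y * by blast
          then have "x = u \<or> x = w" "x' = u \<or> x' = w" using only_w * by blast+
          then show ?thesis using * h c(2) w(3) \<open>z = y\<close> by auto
        next
          case False
          then have "z \<in> Y1" "x \<noteq> u" "x' \<noteq> u" using * by (auto simp: Y1_def)
          then show ?thesis using c(1) * by (auto simp: sparse_choice_def)
        qed
      qed
      then show ?thesis by (intro exI[of _ "c(u := g)"]) simp
    qed
  qed
  have "\<exists>c. sparse_choice adj L M X Y c"
  proof (cases "\<exists>u\<in>X. \<exists>y\<in>Y. adj u y \<and> \<not> L u \<subseteq> M y")
    case True
    then obtain u y g where u: "u \<in> X" and y: "y \<in> Y" "adj u y" and g: "g \<in> L u" "g \<notin> M y"
      by blast
    have "card {y' \<in> Y - {y}. adj u y'} < card {y \<in> Y. adj u y}"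
      using fY y by (intro psubset_card_mono) auto
    then have "card {y' \<in> Y - {y}. adj u y'} \<le> 1" using dX[OF u] by simp
    then obtain c where c: "sparse_choice adj L M X (Y - {y}) c" "c u = g"
      using pre[OF u g(1), of "Y - {y}"] by blast
    \<comment> \<open>Since \<open>g\<close> is not in \<open>M y\<close>, only neighbors of
      \<open>y\<close> other than \<open>u\<close> can cost it a color, and there is at most one; so
      \<open>y\<close> can be put back.\<close>
    have only_u: "x = x'" if "x \<in> X" "x' \<in> X" "adj x y" "adj x' y" "x \<noteq> u" "x' \<noteq> u" for x x'
    proof (rule ccontr)
      assume "x \<noteq> x'"
      then have "card {u, x, x'} = 3" using that by auto
      moreover have "card {u, x, x'} \<le> card {x \<in> X. adj x y}"
        using fX u y that by (intro card_mono) auto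
      ultimately show False using dY[OF y(1)] by simp
    qed
    have "sparse_choice adj L M X Y c"
      unfolding sparse_choice_def
    proof (intro conjI ballI impI)
      fix x assume "x \<in> X"
      then show "c x \<in> L x" using c by (auto simp: sparse_choice_def)
    next
      fix z x x'
      assume *: "z \<in> Y" "x \<in> X" "x' \<in> X" "adj x z" "adj x' z" "c x \<in> M z" "c x' \<in> M z"
      show "c x = c x'"
      proof (cases "z = y")
        case True
        then have "x \<noteq> u" "x' \<noteq> u" using * g c(2) by auto
        then show ?thesis using only_u[of x x'] * True by auto
      next
        case False
        then show ?thesis using c(1) * by (auto simp: sparse_choice_def)
      qed
    qed
    then show ?thesis by blast
  next
    case False
    then have eq: "L x = M y" if "x \<in> X" "y \<in> Y" "adj x y" for x y
      using that L[of x] M[of y] by (metis card_subset_eq)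
    \<comment> \<open>The chosen element depends on the set \<open>L x\<close> alone, and all
      neighbors of \<open>y\<close> have the list \<open>M y\<close>, so they agree.\<close>
    have "sparse_choice adj L M X Y (\<lambda>x. SOME g. g \<in> L x)"
      using eq Lne by (auto simp: sparse_choice_def some_in_eq)
    then show ?thesis by blast
  qed
  then show ?case using pre by blast
qed

section \<open>Losses of lists along matchings\<close>

definition matching :: "'v set set \<Rightarrow> bool" where
  "matching X \<longleftrightarrow> finite X \<and> (\<forall>e\<in>X. card e = 2) \<and> (\<forall>e\<in>X. \<forall>f\<in>X. e \<noteq> f \<longrightarrow> e \<inter> f = {})"

text \<open>An edge \<open>e\<close> of \<open>X\<close> counts as its own neighbor, so removing
  neighbor colors also removes the color that \<open>e\<close> itself received.\<close>

definition neighbors :: "'v set set \<Rightarrow> 'v set \<Rightarrow> 'v set set" where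
  "neighbors X e = {x \<in> X. x \<inter> e \<noteq> {}}"

text \<open>Sending each neighbor to a vertex shared with \<open>e\<close> is injective because
  edges of \<open>X\<close> are disjoint.\<close>

lemma card_neighbors_matching:
  assumes "matching X" "card e = 2"
  shows "finite (neighbors X e)" "card (neighbors X e) \<le> 2"
proof -
  show "finite (neighbors X e)" using assms by (auto simp: matching_def neighbors_def)
  define p where "p x = (SOME v. v \<in> x \<inter> e)" for x
  have p: "p x \<in> x \<inter> e" if "x \<in> neighbors X e" for x
    using that unfolding p_def neighbors_def some_in_eq by simp
  have "inj_on p (neighbors X e)"
  proof (rule inj_onI)
    fix x y assume *: "x \<in> neighbors X e" "y \<in> neighbors X e" "p x = p y"
    then have "x \<inter> y \<noteq> {}" using p[of x] p[of y] by auto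
    then show "x = y" using assms(1) *(1,2) unfolding matching_def neighbors_def by blast
  qed
  moreover have "p ` neighbors X e \<subseteq> e" using p by auto
  moreover have "finite e" using assms(2) card.infinite by fastforce
  ultimately show "card (neighbors X e) \<le> 2" using card_inj_on_le assms(2) by metis
qed

text \<open>The crude bound, for the class that a round of choices does not protect.\<close>

lemma card_Diff_neighbor_colors:
  assumes "matching X" "card e = 2" "finite P" "card P \<ge> k + 2"
  shows "card (P - c ` neighbors X e) \<ge> k"
proof -
  note nb = card_neighbors_matching[OF assms(1,2)]
  have "card (c ` neighbors X e) \<le> 2" using nb card_image_le order_trans by blast
  moreover have "card (P - c ` neighbors X e) \<ge> card P - card (c ` neighbors X e)"
    using nb by (intro diff_card_le_card_Diff) auto
  ultimately show ?thesis using assms(4) by linarith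
qed

lemma matching_color_choice:
  fixes P :: "'v set \<Rightarrow> 'c set"
  assumes X: "matching X" and Y: "matching Y"
    and PX: "\<And>x. x \<in> X \<Longrightarrow> finite (P x) \<and> card (P x) \<ge> Suc k"
    and PY: "\<And>y. y \<in> Y \<Longrightarrow> finite (P y) \<and> card (P y) \<ge> Suc k"
  obtains c where "\<And>x. x \<in> X \<Longrightarrow> c x \<in> P x"
    and "\<And>y. y \<in> Y \<Longrightarrow> card (P y - c ` neighbors X y) \<ge> k"
proof -
  \<comment> \<open>Lists are trimmed to equal size because \<open>sparse_choice_exists_aux\<close>
    compares them by cardinality.\<close>
  define Q where "Q e = (SOME T. T \<subseteq> P e \<and> card T = Suc k \<and> finite T)" for e
  have Q: "Q e \<subseteq> P e \<and> card (Q e) = Suc k \<and> finite (Q e)" if "e \<in> X \<union> Y" for e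
    unfolding Q_def
  proof (rule someI_ex)
    have "Suc k \<le> card (P e)" using that PX PY by auto
    then show "\<exists>T. T \<subseteq> P e \<and> card T = Suc k \<and> finite T"
      by (metis obtain_subset_with_card_n)
  qed
  have "(\<exists>c. sparse_choice (\<lambda>x y. x \<inter> y \<noteq> {}) Q Q X Y c) \<and>
    (\<forall>u\<in>X. \<forall>g\<in>Q u. card {y \<in> Y. u \<inter> y \<noteq> {}} \<le> 1 \<longrightarrow>
      (\<exists>c. sparse_choice (\<lambda>x y. x \<inter> y \<noteq> {}) Q Q X Y c \<and> c u = g))"
  proof (rule sparse_choice_exists_aux)
    show "finite X" "finite Y" "1 \<le> Suc k" using X Y by (auto simp: matching_def)
    show "finite (Q x) \<and> card (Q x) = Suc k" if "x \<in> X" for x using Q that by auto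
    show "finite (Q x) \<and> card (Q x) = Suc k" if "x \<in> Y" for x using Q that by auto
    show "card {y \<in> Y. x \<inter> y \<noteq> {}} \<le> 2" if "x \<in> X" for x
      using card_neighbors_matching(2)[OF Y, of x] X that
      by (simp add: matching_def neighbors_def Int_commute)
    show "card {x \<in> X. x \<inter> y \<noteq> {}} \<le> 2" if "y \<in> Y" for y
      using card_neighbors_matching(2)[OF X, of y] Y that by (simp add: matching_def neighbors_def)
  qed
  then obtain c where c: "sparse_choice (\<lambda>x y. x \<inter> y \<noteq> {}) Q Q X Y c" by blast
  show thesis
  proof
    show "c x \<in> P x" if "x \<in> X" for x using c Q that by (auto simp: sparse_choice_def)
    fix y assume y: "y \<in> Y"
    have "a = b" if "a \<in> Q y \<inter> c ` neighbors X y" "b \<in> Q y \<inter> c ` neighbors X y" for a b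
      using that c y unfolding sparse_choice_def neighbors_def by blast
    then have "card (Q y \<inter> c ` neighbors X y) \<le> 1"
      using Q y by (simp add: card_le_Suc0_iff_eq)
    moreover have "card (Q y - c ` neighbors X y) = card (Q y) - card (Q y \<inter> c ` neighbors X y)"
      using Q y by (intro card_Diff_subset_Int) auto
    moreover have "card (Q y - c ` neighbors X y) \<le> card (P y - c ` neighbors X y)"
      using Q PY y by (intro card_mono) auto
    ultimately show "card (P y - c ` neighbors X y) \<ge> k" using Q[of y] y by simp
  qed
qed

lemma matching_color_class:
  assumes "finite_simple_graph V E"
    and "\<And>e f. e \<in> E \<Longrightarrow> f \<in> E \<Longrightarrow> incident_edges e f \<Longrightarrow> c e \<noteq> c f"
  shows "matching {e \<in> E. c e = i}"
proof -
  have "E \<subseteq> Pow V" "finite V" using assms(1) by (auto simp: finite_simple_graph_def)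
  then have "finite E" using finite_subset by blast
  then show ?thesis
    using assms by (fastforce simp: matching_def finite_simple_graph_def incident_edges_def)
qed

section \<open>Four rounds of choices and the final color sets\<close>

theorem theorem1:
  fixes V :: "'v set" and E :: "'v set set"
  assumes "finite_simple_graph V E"
    and "edge_colorable 3 E"
  shows "edge_choosable TYPE('c) 7 2 E"
  unfolding edge_choosable_def
proof (intro allI impI)
  fix L :: "'v set \<Rightarrow> 'c set"
  assume L: "\<forall>e\<in>E. finite (L e) \<and> card (L e) = 7"
  obtain col :: "'v set \<Rightarrow> nat" where lt: "\<And>e. e \<in> E \<Longrightarrow> col e < 3"
    and proper: "\<And>e f. e \<in> E \<Longrightarrow> f \<in> E \<Longrightarrow> incident_edges e f \<Longrightarrow> col e \<noteq> col f"
    using assms(2) unfolding edge_colorable_def by blast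
  define A B C where ABC: "A = {e \<in> E. col e = 0}" "B = {e \<in> E. col e = 1}" "C = {e \<in> E. col e = 2}"
  have match: "matching A" "matching B" "matching C"
    unfolding ABC by (rule matching_color_class[OF assms(1)]; use proper in blast)+
  have E: "E = A \<union> B \<union> C" using lt by (fastforce simp: ABC)
  have disj: "A \<inter> B = {}" "A \<inter> C = {}" "B \<inter> C = {}" by (auto simp: ABC)
  have two: "card e = 2" if "e \<in> E" for e using assms(1) that by (simp add: finite_simple_graph_def)

  \<comment> \<open>Round one protects \<open>A\<close>, which keeps 6 of 7 colors; \<open>B\<close>
    may lose two, and each edge of \<open>C\<close> loses the color just used.\<close>
  obtain c1 where c1: "\<And>e. e \<in> C \<Longrightarrow> c1 e \<in> L e"
    and A1: "\<And>e. e \<in> A \<Longrightarrow> card (L e - c1 ` neighbors C e) \<ge> 6"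
    using matching_color_choice[OF match(3,1), of L 6] L E by auto
  define L1 where "L1 e = L e - c1 ` neighbors C e" for e
  have C1: "L1 e = L e - {c1 e}" if "e \<in> C" for e
  proof -
    have "neighbors C e = {e}"
      using that match(3) two[of e] E by (auto simp: matching_def neighbors_def)
    then show ?thesis by (simp add: L1_def)
  qed
  have fin1: "finite (L1 e)" if "e \<in> E" for e using L that by (simp add: L1_def)
  have B1: "card (L1 e) \<ge> 5" if "e \<in> B" for e
    unfolding L1_def using L that E two by (intro card_Diff_neighbor_colors match) auto
  have C1': "card (L1 e) = 6" if "e \<in> C" for e
    using C1 c1 L E that by simp

  \<comment> \<open>Round two protects \<open>B\<close>, going from 5 to 4, while \<open>A\<close>
    drops from 6 to 4.\<close>
  obtain c2 where c2: "\<And>e. e \<in> C \<Longrightarrow> c2 e \<in> L1 e"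
    and B2: "\<And>e. e \<in> B \<Longrightarrow> card (L1 e - c2 ` neighbors C e) \<ge> 4"
    using matching_color_choice[OF match(3,2), of L1 4] fin1 B1 C1' E by auto
  define L2 where "L2 e = L1 e - c2 ` neighbors C e" for e
  have fin2: "finite (L2 e)" if "e \<in> E" for e using fin1 that by (simp add: L2_def)
  have A2: "card (L2 e) \<ge> 4" if "e \<in> A" for e
    unfolding L2_def using A1[of e] fin1 that E two
    by (intro card_Diff_neighbor_colors match) (auto simp: L1_def)

  obtain c3 where c3: "\<And>e. e \<in> A \<Longrightarrow> c3 e \<in> L2 e"
    and B3: "\<And>e. e \<in> B \<Longrightarrow> card (L2 e - c3 ` neighbors A e) \<ge> 3"
    using matching_color_choice[OF match(1,2), of L2 3] fin2 A2 B2 E by (auto simp: L2_def)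
  define L3 where "L3 e = L2 e - c3 ` neighbors A e" for e
  have A3: "L3 e = L2 e - {c3 e}" if "e \<in> A" for e
  proof -
    have "neighbors A e = {e}"
      using that match(1) two[of e] E by (auto simp: matching_def neighbors_def)
    then show ?thesis by (simp add: L3_def)
  qed
  have fin3: "finite (L3 e)" if "e \<in> E" for e using fin2 that by (simp add: L3_def)
  have A3': "card (L3 e) \<ge> 3" if "e \<in> A" for e
    using A3[OF that] c3[OF that] A2[OF that] by simp

  \<comment> \<open>Both \<open>A\<close> and \<open>B\<close> have at least 3 colors left; this
    round leaves \<open>B\<close> the 2 it needs.\<close>
  obtain c4 where c4: "\<And>e. e \<in> A \<Longrightarrow> c4 e \<in> L3 e"
    and B4: "\<And>e. e \<in> B \<Longrightarrow> card (L3 e - c4 ` neighbors A e) \<ge> 2"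
    using matching_color_choice[OF match(1,2), of L3 2] fin3 A3' B3 E by (auto simp: L3_def)
  define L4 where "L4 e = L3 e - c4 ` neighbors A e" for e
  have "\<exists>T. T \<subseteq> L4 e \<and> card T = 2" if "e \<in> B" for e
    using B4[OF that] unfolding L4_def by (metis obtain_subset_with_card_n)
  then obtain T where T: "\<And>e. e \<in> B \<Longrightarrow> T e \<subseteq> L4 e \<and> card (T e) = 2" by metis

  define S where "S e = (if e \<in> C then {c1 e, c2 e} else if e \<in> A then {c3 e, c4 e} else T e)" for e
  have SC: "S e = {c1 e, c2 e}" if "e \<in> C" for e using that by (simp add: S_def)
  have SA: "S e = {c3 e, c4 e}" if "e \<in> A" for e using that disj by (auto simp: S_def)
  have SB: "S e = T e" if "e \<in> B" for e using that disj by (auto simp: S_def)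
  have sub: "L4 e \<subseteq> L3 e" "L3 e \<subseteq> L2 e" "L2 e \<subseteq> L1 e" "L1 e \<subseteq> L e" for e
    by (auto simp: L1_def L2_def L3_def L4_def)
  \<comment> \<open>\<open>L2\<close> has lost both colors of every neighbor in \<open>C\<close>, so
    this containment settles all conflicts with \<open>C\<close>.\<close>
  have S2: "S e \<subseteq> L2 e" if "e \<in> A \<union> B" for e
  proof (cases "e \<in> A")
    case True
    then show ?thesis using SA c3[of e] c4[of e] sub[of e] by auto
  next
    case False
    then show ?thesis using that SB T[of e] sub[of e] by auto
  qed
  have SL: "S e \<subseteq> L e \<and> card (S e) = 2" if e: "e \<in> E" for e
  proof -
    consider "e \<in> A" | "e \<in> B" | "e \<in> C" using e E by blast
    then show ?thesis
    proof cases
      case 1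
      have "c3 e \<noteq> c4 e" using c4[OF 1] unfolding A3[OF 1] by (metis DiffD2 singletonI)
      moreover have "S e \<subseteq> L e" using S2[of e] sub(3,4)[of e] 1 by blast
      ultimately show ?thesis by (simp add: SA[OF 1])
    next
      case 2
      have "S e \<subseteq> L e" using S2[of e] sub(3,4)[of e] 2 by blast
      then show ?thesis using T[OF 2] by (simp add: SB[OF 2])
    next
      case 3
      have "c1 e \<noteq> c2 e" using c2[OF 3] unfolding C1[OF 3] by (metis DiffD2 singletonI)
      then show ?thesis using c1[OF 3] c2[OF 3] sub(4)[of e] by (auto simp: SC[OF 3])
    qed
  qed
  have disj_C: "S e \<inter> S f = {}" if "e \<in> A \<union> B" "f \<in> C" "incident_edges e f" for e f
  proof -
    have "f \<in> neighbors C e" using that by (auto simp: neighbors_def incident_edges_def)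
    then have "S f \<inter> L2 e = {}" using SC[OF that(2)] by (auto simp: L2_def L1_def)
    then show ?thesis using S2[OF that(1)] by blast
  qed
  have disj_A: "S e \<inter> S f = {}" if "e \<in> B" "f \<in> A" "incident_edges e f" for e f
  proof -
    have "f \<in> neighbors A e" using that by (auto simp: neighbors_def incident_edges_def)
    then have "S f \<inter> L4 e = {}" using SA[OF that(2)] by (auto simp: L4_def L3_def)
    then show ?thesis using SB[OF that(1)] T[OF that(1)] by blast
  qed
  have "S e \<inter> S f = {}" if ef: "e \<in> E" "f \<in> E" "incident_edges e f" for e f
  proof -
    have inc: "incident_edges f e" using that by (auto simp: incident_edges_def)
    have "col e \<noteq> col f" using proper that by blast
    then consider "e \<in> A \<union> B \<and> f \<in> C" | "f \<in> A \<union> B \<and> e \<in> C" | "e \<in> B \<and> f \<in> A" | "f \<in> B \<and> e \<in> A"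
      using ef(1,2) lt[of e] lt[of f] by (fastforce simp: ABC less_Suc_eq numeral_3_eq_3)
    then show ?thesis
      using disj_C[of e f] disj_C[of f e] disj_A[of e f] disj_A[of f e] ef(3) inc
      by cases (auto simp: Int_commute)
  qed
  then show "\<exists>S. (\<forall>e\<in>E. S e \<subseteq> L e \<and> card (S e) = 2) \<and>
      (\<forall>e\<in>E. \<forall>f\<in>E. incident_edges e f \<longrightarrow> S e \<inter> S f = {})"
    using SL by blast
qed

end
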